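(* Let $S$ be a closed, connected, oriented surface of genus $g\ge1$ and let $n\ge1$. The action of the Torelli group $\mathcal{I}(S)$ on the representation space $\mathrm{Hom}(\pi_1(S),\mathbb{T}^n)$ is trivial.
   Context: $\mathbb{T}^n=(\mathbb{S}^1)^n$ is the $n$-dimensional torus. The mapping class group $\mathrm{Mod}(S)$ (isotopy classes of homeomorphisms of $S$, identified with outer automorphisms of $\pi_1(S)$) acts on $\mathrm{Hom}(\pi_1(S),\mathbb{T}^n)$ by $\phi\cdot\rho=\rho\circ\phi^{-1}$, which is well defined since $\mathbb{T}^n$ is abelian. The Torelli group $\mathcal{I}(S)$ is the subgroup of $\mathrm{Mod}(S)$ of mapping classes acting trivially on $\mathrm{H}_1(S,\mathbb{Z})$, i.e. the kernel of the symplectic representation $\mu:\mathrm{Mod}(S)\to\mathrm{Sp}(2g,\mathbb{Z})$. *)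

theory Defs
  imports "HOL-Analysis.Analysis" "HOL-Algebra.Bij" "HOL-Algebra.Product_Groups" "HOL-Homology.Homology"
begin

section \<open>Closed oriented surfaces\<close>

text \<open>A surface is the subspace carried by a set \<open>S\<close> in an arbitrary topological space.\<close>

definition closed_connected_surface :: "'a::topological_space set \<Rightarrow> bool" where
  "closed_connected_surface S \<longleftrightarrow>
     S \<noteq> {} \<and> connected S \<and> compact S \<and>
     Hausdorff_space (top_of_set S) \<and> second_countable (top_of_set S) \<and>
     (\<forall>x\<in>S. \<exists>U V. openin (top_of_set S) U \<and> x \<in> U \<and>
              open (V :: (real^2) set) \<and> U homeomorphic V)"

text \<open>An orientation is a choice, for each point \<open>x\<close>, of a generator \<open>ori x\<close> of the local
  homology group \<open>H\<^sub>2(X, X - x)\<close> that is locally the image of a single class in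
  \<open>H\<^sub>2(X, X - U)\<close>.\<close>

definition is_orientation :: "'a topology \<Rightarrow> ('a \<Rightarrow> 'a chain set) \<Rightarrow> bool" where
  "is_orientation X ori \<longleftrightarrow>
     (\<forall>x\<in>topspace X.
        ori x \<in> carrier (relative_homology_group 2 X (topspace X - {x})) \<and>
        generate (relative_homology_group 2 X (topspace X - {x})) {ori x}
          = carrier (relative_homology_group 2 X (topspace X - {x}))) \<and>
     (\<forall>x\<in>topspace X. \<exists>U. openin X U \<and> x \<in> U \<and>
        (\<exists>c \<in> carrier (relative_homology_group 2 X (topspace X - U)).
           \<forall>y\<in>U. hom_induced 2 X (topspace X - U) X (topspace X - {y}) id c = ori y))"

text \<open>The genus is the largest number of pairwise disjoint simple closed curves whose union
  does not separate the surface.\<close>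

definition nonseparating_curves :: "'a::topological_space set \<Rightarrow> nat \<Rightarrow> bool" where
  "nonseparating_curves S k \<longleftrightarrow>
     (\<exists>c :: nat \<Rightarrow> real \<Rightarrow> 'a.
        (\<forall>i<k. simple_path (c i) \<and> pathfinish (c i) = pathstart (c i) \<and> path_image (c i) \<subseteq> S) \<and>
        disjoint_family_on (\<lambda>i. path_image (c i)) {..<k} \<and>
        connected (S - (\<Union>i<k. path_image (c i))))"

definition has_genus :: "'a::topological_space set \<Rightarrow> nat \<Rightarrow> bool" where
  "has_genus S g \<longleftrightarrow>
     nonseparating_curves S g \<and> (\<forall>k. nonseparating_curves S k \<longrightarrow> k \<le> g)"

section \<open>The fundamental group\<close>

definition loops_at :: "'a::topological_space set \<Rightarrow> 'a \<Rightarrow> (real \<Rightarrow> 'a) set" where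
  "loops_at S x = {p. path p \<and> path_image p \<subseteq> S \<and> pathstart p = x \<and> pathfinish p = x}"

definition path_class :: "'a::topological_space set \<Rightarrow> (real \<Rightarrow> 'a) \<Rightarrow> (real \<Rightarrow> 'a) set" where
  "path_class S p = {q. homotopic_paths S p q}"

definition fundamental_group :: "'a::topological_space set \<Rightarrow> 'a \<Rightarrow> (real \<Rightarrow> 'a) set monoid" where
  "fundamental_group S x =
     \<lparr>carrier = path_class S ` loops_at S x,
      mult = \<lambda>A B. \<Union>p\<in>A. \<Union>q\<in>B. path_class S (p +++ q),
      one = path_class S (\<lambda>_. x)\<rparr>"

section \<open>Mapping class group and Torelli group\<close>

text \<open>As in \<^const>\<open>BijGroup\<close>, homeomorphisms are extensional functions.\<close>

definition homeo_group :: "'a::topological_space set \<Rightarrow> ('a \<Rightarrow> 'a) monoid" where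
  "homeo_group S =
     BijGroup S \<lparr>carrier := {f \<in> extensional S.
                     homeomorphic_map (top_of_set S) (top_of_set S) f}\<rparr>"

definition isotopic :: "'a::topological_space set \<Rightarrow> (('a \<Rightarrow> 'a) \<times> ('a \<Rightarrow> 'a)) set" where
  "isotopic S =
     {(f, g). f \<in> carrier (homeo_group S) \<and> g \<in> carrier (homeo_group S) \<and>
        homotopic_with (\<lambda>h. homeomorphic_map (top_of_set S) (top_of_set S) h)
          (top_of_set S) (top_of_set S) f g}"

text \<open>No preservation of orientation is imposed. For a surface of positive genus this does not
  affect the Torelli group below, since a homeomorphism acting trivially on \<open>H\<^sub>1\<close> preserves the
  intersection form and hence the orientation.\<close>

definition mapping_class_group :: "'a::topological_space set \<Rightarrow> ('a \<Rightarrow> 'a) set monoid" where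
  "mapping_class_group S =
     \<lparr>carrier = carrier (homeo_group S) // isotopic S,
      mult = \<lambda>A B. \<Union>f\<in>A. \<Union>g\<in>B. isotopic S `` {f \<otimes>\<^bsub>homeo_group S\<^esub> g},
      one = isotopic S `` {\<one>\<^bsub>homeo_group S\<^esub>}\<rparr>"

text \<open>The automorphism of \<open>H\<^sub>1(S, \<int>)\<close> induced by a mapping class, that is, by any homeomorphism
  representing it. On orientation-preserving classes this is, in a symplectic basis, the symplectic
  representation.\<close>

definition homology_rep ::
  "'a::topological_space set \<Rightarrow> ('a \<Rightarrow> 'a) set \<Rightarrow> 'a chain set \<Rightarrow> 'a chain set" where
  "homology_rep S \<phi> =
     (THE h. \<exists>f\<in>\<phi>. h = restrict (hom_induced 1 (top_of_set S) {} (top_of_set S) {} f)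
                          (carrier (homology_group 1 (top_of_set S))))"

definition torelli_group :: "'a::topological_space set \<Rightarrow> ('a \<Rightarrow> 'a) set set" where
  "torelli_group S =
     kernel (mapping_class_group S) (AutoGroup (homology_group 1 (top_of_set S)))
       (homology_rep S)"

section \<open>The action on representations into a torus\<close>

definition circle_group :: "complex monoid" where
  "circle_group = \<lparr>carrier = sphere 0 1, mult = (*), one = 1\<rparr>"

definition torus_group :: "nat \<Rightarrow> (nat \<Rightarrow> complex) monoid" where
  "torus_group n = product_group {..<n} (\<lambda>_. circle_group)"

text \<open>Extensionality makes equality of representations mean equality on the group.\<close>

definition rep_space :: "('a, 'c) monoid_scheme \<Rightarrow> ('b, 'd) monoid_scheme \<Rightarrow> ('a \<Rightarrow> 'b) set" where
  "rep_space G H = hom G H \<inter> extensional (carrier G)"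

text \<open>A homeomorphism \<open>f\<close> need not fix the base point \<open>x\<close>; a path \<open>\<gamma>\<close> from \<open>x\<close> to \<open>f x\<close> turns it
  into the automorphism \<open>[p] \<mapsto> [\<gamma> (f \<circ> p) \<gamma>\<^sup>-\<^sup>1]\<close> of the fundamental group at \<open>x\<close>.\<close>

definition induced_auto ::
  "'a::topological_space set \<Rightarrow> 'a \<Rightarrow> ('a \<Rightarrow> 'a) \<Rightarrow> (real \<Rightarrow> 'a) \<Rightarrow>
     (real \<Rightarrow> 'a) set \<Rightarrow> (real \<Rightarrow> 'a) set" where
  "induced_auto S x f \<gamma> =
     (\<lambda>A \<in> carrier (fundamental_group S x).
        \<Union>p\<in>A. path_class S (\<gamma> +++ ((f \<circ> p) +++ reversepath \<gamma>)))"

text \<open>The outer automorphism (coset of inner automorphisms) determined by a mapping class: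
  changing \<open>\<gamma>\<close>, or the representative \<open>f\<close>, changes the automorphism by an inner one.\<close>

definition outer_auto ::
  "'a::topological_space set \<Rightarrow> 'a \<Rightarrow> ('a \<Rightarrow> 'a) set \<Rightarrow>
     ((real \<Rightarrow> 'a) set \<Rightarrow> (real \<Rightarrow> 'a) set) set" where
  "outer_auto S x \<phi> =
     {induced_auto S x f \<gamma> | f \<gamma>.
        f \<in> \<phi> \<and> path \<gamma> \<and> path_image \<gamma> \<subseteq> S \<and> pathstart \<gamma> = x \<and> pathfinish \<gamma> = f x}"

text \<open>\<open>\<phi> \<cdot> \<rho> = \<rho> \<circ> \<phi>\<^sup>-\<^sup>1\<close>, meaningful when the target of \<open>\<rho>\<close> is abelian: the value is then the same
  for all automorphisms in the outer class.\<close>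

definition mod_action ::
  "'a::topological_space set \<Rightarrow> 'a \<Rightarrow> ('a \<Rightarrow> 'a) set \<Rightarrow>
     ((real \<Rightarrow> 'a) set \<Rightarrow> 'b) \<Rightarrow> ((real \<Rightarrow> 'a) set \<Rightarrow> 'b)" where
  "mod_action S x \<phi> \<rho> =
     (THE \<rho>'. \<exists>a \<in> outer_auto S x \<phi>.
        \<rho>' = compose (carrier (fundamental_group S x)) \<rho>
               (inv\<^bsub>AutoGroup (fundamental_group S x)\<^esub> a))"

end

theory Submission
  imports Defs
begin

text \<open>A representation \<open>\<rho>\<close> into an abelian group extends multiplicatively to all paths, by closing each
  path up with chosen paths from the base point. Two consecutive edges of a singular triangle are
  homotopic to the third, so the extension is a singular 1-cocycle and takes equal values on homologous
  loops. If \<open>f\<close> represents a Torelli class, then \<open>p\<close> and \<open>f \<circ> p\<close> are homologous for every loop \<open>p\<close>; since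
  the extension does not change when a loop is conjugated by a path, \<open>\<rho>\<close> agrees on \<open>p\<close> and on
  \<open>\<gamma> (f \<circ> p) \<gamma>\<^sup>-\<^sup>1\<close>.\<close>

section \<open>Homotopies of paths\<close>

text \<open>Equality in H_1 only provides a 2-chain whose triangles have arbitrary paths as edges,
  rarely loops at \<open>x\<close>. A representation evaluates nothing but loops at
  \<open>x\<close>, and this forces its extension to all paths. The extension also settles the base
  point problem: \<open>f \<circ> p\<close> is a loop at \<open>f x\<close>, and it can be compared
  with \<open>p\<close> directly. A second obstacle is that the action is a definite description
  containing an inverse in the automorphism group. Each \<open>induced_auto\<close> must therefore
  be shown to be an automorphism, all of them must give the same value, and at least one must exist.
  Path connectedness of \<open>S\<close> serves this last point and also supplies the closing paths.
  Paths are functions on the whole real line, whereas only their values on the unit interval are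
  controlled. Many identities that look like equations between paths are therefore stated as
  homotopies.\<close>

lemma homotopic_paths_compose_unit_interval:
  assumes "path p" "path_image p \<subseteq> S" "path u" "path v" "path_image u \<subseteq> {0..1}" "path_image v \<subseteq> {0..1}"
    and "pathstart u = pathstart v" "pathfinish u = pathfinish v"
  shows "homotopic_paths S (p \<circ> u) (p \<circ> v)"
proof (rule homotopic_paths_continuous_image)
  have "simply_connected {0..1::real}"
    by (simp add: convex_imp_simply_connected)
  with assms show "homotopic_paths {0..1} u v"
    by (simp add: simply_connected_eq_homotopic_paths)
qed (use assms in \<open>auto simp: path_def path_image_def\<close>)

lemma path_id [simp]: "path (\<lambda>t. t)"
  by (simp add: path_def)

lemma path_image_const_subset: "path_image (\<lambda>_. a) \<subseteq> S \<longleftrightarrow> a \<in> S"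
  by (auto simp: path_image_def)

lemma path_const [simp]: "path (\<lambda>_. a)"
  by (simp add: path_def)

lemma pathstart_const [simp]: "pathstart (\<lambda>_. a) = a"
  and pathfinish_const [simp]: "pathfinish (\<lambda>_. a) = a"
  by (auto simp: pathstart_def pathfinish_def)

lemma homotopic_paths_const_left:
  assumes "path p" "path_image p \<subseteq> S" "pathstart p = a"
  shows "homotopic_paths S ((\<lambda>_. a) +++ p) p"
proof -
  \<comment> \<open>The unit and inverse laws are reparametrizations of \<open>p\<close>. They
    reduce to homotopies inside the unit interval, which is convex, and so hold in an arbitrary
    topological space.\<close>
  have "(\<lambda>_. a) +++ p = p \<circ> ((\<lambda>_. 0) +++ (\<lambda>t. t))"
    using assms by (auto simp: joinpaths_def pathstart_def)
  moreover have "path ((\<lambda>_. 0) +++ (\<lambda>t. t) :: real \<Rightarrow> real)"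
    by (rule path_join_imp) (auto intro!: continuous_intros simp: path_def pathstart_def pathfinish_def)
  then have "homotopic_paths S (p \<circ> ((\<lambda>_. 0) +++ (\<lambda>t. t))) (p \<circ> (\<lambda>t. t))"
    by (rule homotopic_paths_compose_unit_interval[OF assms(1,2)])
       (auto simp: path_image_def pathstart_def pathfinish_def joinpaths_def)
  ultimately show ?thesis by (simp add: o_def)
qed

lemma homotopic_paths_const_right:
  assumes "path p" "path_image p \<subseteq> S" "pathfinish p = a"
  shows "homotopic_paths S (p +++ (\<lambda>_. a)) p"
proof -
  have "p +++ (\<lambda>_. a) = p \<circ> ((\<lambda>t. t) +++ (\<lambda>_. 1))"
    using assms by (auto simp: joinpaths_def pathfinish_def)
  moreover have "path ((\<lambda>t. t) +++ (\<lambda>_. 1) :: real \<Rightarrow> real)"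
    by (rule path_join_imp) (auto intro!: continuous_intros simp: path_def pathstart_def pathfinish_def)
  then have "homotopic_paths S (p \<circ> ((\<lambda>t. t) +++ (\<lambda>_. 1))) (p \<circ> (\<lambda>t. t))"
    by (rule homotopic_paths_compose_unit_interval[OF assms(1,2)])
       (auto simp: path_image_def pathstart_def pathfinish_def joinpaths_def)
  ultimately show ?thesis by (simp add: o_def)
qed

lemma homotopic_paths_join_reversepath:
  assumes "path p" "path_image p \<subseteq> S" "pathstart p = a"
  shows "homotopic_paths S (p +++ reversepath p) (\<lambda>_. a)"
proof -
  have "p +++ reversepath p = p \<circ> ((\<lambda>t. t) +++ (\<lambda>t. 1 - t))"
    by (auto simp: joinpaths_def reversepath_def)
  moreover have "path ((\<lambda>t. t) +++ (\<lambda>t. 1 - t) :: real \<Rightarrow> real)"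
    by (rule path_join_imp) (auto intro!: continuous_intros simp: path_def pathstart_def pathfinish_def)
  then have "homotopic_paths S (p \<circ> ((\<lambda>t. t) +++ (\<lambda>t. 1 - t))) (p \<circ> (\<lambda>_. 0))"
    by (rule homotopic_paths_compose_unit_interval[OF assms(1,2)])
       (auto simp: path_image_def pathstart_def pathfinish_def joinpaths_def)
  ultimately show ?thesis using assms by (simp add: o_def pathstart_def)
qed

lemma homotopic_paths_reversepath_join:
  assumes "path p" "path_image p \<subseteq> S" "pathfinish p = a"
  shows "homotopic_paths S (reversepath p +++ p) (\<lambda>_. a)"
  using homotopic_paths_join_reversepath[of "reversepath p" S a] assms by simp

lemma homotopic_paths_cancel_middle:
  assumes p: "path p" "path_image p \<subseteq> S" and q: "path q" "path_image q \<subseteq> S"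
    and r: "path r" "path_image r \<subseteq> S"
    and ends: "pathfinish p = pathstart r" "pathstart q = pathstart r"
  shows "homotopic_paths S ((p +++ r) +++ (reversepath r +++ q)) (p +++ q)"
proof -
  have r_join_q: "homotopic_paths S (r +++ (reversepath r +++ q)) q"
  proof -
    have "homotopic_paths S (r +++ (reversepath r +++ q)) ((r +++ reversepath r) +++ q)"
      using assms by (intro homotopic_paths_assoc) auto
    also have "homotopic_paths S \<dots> ((\<lambda>_. pathstart q) +++ q)"
      using assms by (intro homotopic_paths_join homotopic_paths_join_reversepath) auto
    also have "homotopic_paths S \<dots> q"
      using assms by (intro homotopic_paths_const_left) auto
    finally show ?thesis .
  qed
  have "homotopic_paths S (p +++ (r +++ (reversepath r +++ q))) ((p +++ r) +++ (reversepath r +++ q))"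
    using assms by (intro homotopic_paths_assoc) (auto simp: subset_path_image_join)
  moreover have "homotopic_paths S (p +++ (r +++ (reversepath r +++ q))) (p +++ q)"
    using assms r_join_q by (intro homotopic_paths_join) auto
  ultimately show ?thesis
    using homotopic_paths_sym homotopic_paths_trans by blast
qed

text \<open>Being joined by a path is an equivalence relation, and charts make its classes open. A
  connected set then has only one class.\<close>

lemma path_connected_if_locally_euclidean:
  fixes S :: "'a::topological_space set"
  assumes "connected S"
    and "\<And>x. x \<in> S \<Longrightarrow> \<exists>U V. openin (top_of_set S) U \<and> x \<in> U \<and> open (V :: 'b::real_normed_vector set) \<and> U homeomorphic V"
  shows "path_connected S"
  unfolding path_connected_component
proof (intro ballI)
  fix a b assume "a \<in> S" "b \<in> S"
  show "path_component S a b"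
  proof (rule connected_equivalence_relation[OF \<open>connected S\<close> \<open>a \<in> S\<close> \<open>b \<in> S\<close>])
    show "path_component S y x" if "path_component S x y" for x y
      using that by (rule path_component_sym)
    show "path_component S x z" if "path_component S x y" "path_component S y z" for x y z
      using that by (rule path_component_trans)
    show "\<exists>T. openin (top_of_set S) T \<and> z \<in> T \<and> (\<forall>y\<in>T. path_component S z y)" if "z \<in> S" for z
    proof -
      obtain U and V :: "'b set" where U: "openin (top_of_set S) U" "z \<in> U" and "open V" and hom: "U homeomorphic V"
        using assms(2)[OF \<open>z \<in> S\<close>] by blast
      then obtain h k where hk: "homeomorphism V U h k"
        using homeomorphic_def homeomorphic_sym by blast
      \<comment> \<open>The chart image \<open>V\<close> may be disconnected, so it is replaced by a
        ball around \<open>k z\<close>.\<close>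
      have "k z \<in> V" using hk U by (auto simp: homeomorphism_def)
      with \<open>open V\<close> obtain e where "e > 0" and e: "ball (k z) e \<subseteq> V"
        by (meson open_contains_ball)
      have "openin (top_of_set V) (ball (k z) e)"
        using e by (simp add: open_openin_trans \<open>open V\<close>)
      then have "openin (top_of_set U) (h ` ball (k z) e)"
        using hk homeomorphism_imp_open_map by blast
      then have op: "openin (top_of_set S) (h ` ball (k z) e)"
        using U openin_trans by blast
      have "path_connected (h ` ball (k z) e)"
        using hk e by (intro path_connected_continuous_image) (auto simp: homeomorphism_def convex_imp_path_connected intro: continuous_on_subset)
      moreover have "z \<in> h ` ball (k z) e"
        using hk U \<open>e > 0\<close> by (force simp: homeomorphism_def)
      ultimately have "\<forall>y \<in> h ` ball (k z) e. path_component S z y"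
        using op openin_imp_subset path_component_of_subset path_connected_component by metis
      then show ?thesis using op \<open>z \<in> h ` ball (k z) e\<close> by blast
    qed
  qed
qed

section \<open>The fundamental group and its induced automorphisms\<close>

lemma path_class_eqI:
  assumes "homotopic_paths S p q"
  shows "path_class S p = path_class S q"
proof -
  have "homotopic_paths S p r \<longleftrightarrow> homotopic_paths S q r" for r
    using assms homotopic_paths_sym homotopic_paths_trans by blast
  then show ?thesis
    by (simp add: path_class_def)
qed

lemma path_class_eq_iff:
  assumes "path p" "path_image p \<subseteq> S"
  shows "path_class S p = path_class S q \<longleftrightarrow> homotopic_paths S p q"
proof
  assume "path_class S p = path_class S q"
  moreover have "p \<in> path_class S p"
    using assms by (simp add: path_class_def)
  ultimately show "homotopic_paths S p q"
    by (simp add: path_class_def homotopic_paths_sym)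
qed (rule path_class_eqI)

text \<open>Operations on homotopy classes are defined as unions over all representatives. Once the
  result is the same for each of them, the union collapses to the value at one
  representative.\<close>

lemma UN_path_class:
  assumes "path p" "path_image p \<subseteq> S"
    and "\<And>q. homotopic_paths S p q \<Longrightarrow> F q = F p"
  shows "(\<Union>q\<in>path_class S p. F q) = F p"
proof -
  have "p \<in> path_class S p"
    using assms(1,2) by (simp add: path_class_def)
  moreover have "F q = F p" if "q \<in> path_class S p" for q
    using that assms(3) by (simp add: path_class_def)
  ultimately show ?thesis
    by blast
qed

lemma loops_at_iff: "p \<in> loops_at S x \<longleftrightarrow> path p \<and> path_image p \<subseteq> S \<and> pathstart p = x \<and> pathfinish p = x"
  by (simp add: loops_at_def)

lemma carrier_fundamental_group: "carrier (fundamental_group S x) = path_class S ` loops_at S x"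
  and one_fundamental_group: "\<one>\<^bsub>fundamental_group S x\<^esub> = path_class S (\<lambda>_. x)"
  by (simp_all add: fundamental_group_def)

lemma path_class_in_fundamental_group:
  "p \<in> loops_at S x \<Longrightarrow> path_class S p \<in> carrier (fundamental_group S x)"
  by (simp add: carrier_fundamental_group)

lemma loops_at_join: "\<lbrakk>p \<in> loops_at S x; q \<in> loops_at S x\<rbrakk> \<Longrightarrow> p +++ q \<in> loops_at S x"
  by (auto simp: loops_at_iff subset_path_image_join)

lemma loops_at_reversepath: "p \<in> loops_at S x \<Longrightarrow> reversepath p \<in> loops_at S x"
  by (auto simp: loops_at_iff)

lemma const_in_loops_at: "x \<in> S \<Longrightarrow> (\<lambda>_. x) \<in> loops_at S x"
  by (auto simp: loops_at_iff path_image_const_subset)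

lemma mult_fundamental_group:
  assumes "p \<in> loops_at S x" "q \<in> loops_at S x"
  shows "path_class S p \<otimes>\<^bsub>fundamental_group S x\<^esub> path_class S q = path_class S (p +++ q)"
proof -
  have "p \<in> path_class S p" "q \<in> path_class S q"
    using assms by (simp_all add: path_class_def loops_at_iff)
  moreover have "path_class S (p' +++ q') = path_class S (p +++ q)"
    if "p' \<in> path_class S p" "q' \<in> path_class S q" for p' q'
  proof -
    have "homotopic_paths S (p +++ q) (p' +++ q')"
      using assms that by (intro homotopic_paths_join) (auto simp: path_class_def loops_at_iff)
    then show ?thesis
      by (simp add: path_class_eqI)
  qed
  ultimately have "(\<Union>p'\<in>path_class S p. \<Union>q'\<in>path_class S q. path_class S (p' +++ q')) = path_class S (p +++ q)"
    by blast
  then show ?thesis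
    by (simp add: fundamental_group_def)
qed

lemma group_fundamental_group:
  assumes "x \<in> S"
  shows "group (fundamental_group S x)"
proof (rule groupI)
  let ?G = "fundamental_group S x"
  show "\<one>\<^bsub>?G\<^esub> \<in> carrier ?G"
    using assms by (simp add: one_fundamental_group path_class_in_fundamental_group const_in_loops_at)
  show "A \<otimes>\<^bsub>?G\<^esub> B \<in> carrier ?G" if "A \<in> carrier ?G" "B \<in> carrier ?G" for A B
    using that by (auto simp: carrier_fundamental_group mult_fundamental_group loops_at_join)
  show "A \<otimes>\<^bsub>?G\<^esub> B \<otimes>\<^bsub>?G\<^esub> C = A \<otimes>\<^bsub>?G\<^esub> (B \<otimes>\<^bsub>?G\<^esub> C)"
    if ABC: "A \<in> carrier ?G" "B \<in> carrier ?G" "C \<in> carrier ?G" for A B C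
  proof -
    obtain p q r where pqr: "p \<in> loops_at S x" "q \<in> loops_at S x" "r \<in> loops_at S x"
      and "A = path_class S p" "B = path_class S q" "C = path_class S r"
      using ABC by (auto simp: carrier_fundamental_group)
    moreover have "homotopic_paths S (p +++ (q +++ r)) ((p +++ q) +++ r)"
      using pqr by (intro homotopic_paths_assoc) (auto simp: loops_at_iff)
    ultimately show ?thesis
      by (simp add: mult_fundamental_group loops_at_join path_class_eqI)
  qed
  show "\<one>\<^bsub>?G\<^esub> \<otimes>\<^bsub>?G\<^esub> A = A" if "A \<in> carrier ?G" for A
  proof -
    obtain p where p: "p \<in> loops_at S x" and "A = path_class S p"
      using \<open>A \<in> carrier ?G\<close> by (auto simp: carrier_fundamental_group)
    moreover from p have "path_class S ((\<lambda>_. x) +++ p) = path_class S p"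
      by (intro path_class_eqI homotopic_paths_const_left) (auto simp: loops_at_iff)
    ultimately show ?thesis
      using assms by (simp add: one_fundamental_group mult_fundamental_group const_in_loops_at)
  qed
  show "\<exists>B\<in>carrier ?G. B \<otimes>\<^bsub>?G\<^esub> A = \<one>\<^bsub>?G\<^esub>" if "A \<in> carrier ?G" for A
  proof -
    obtain p where p: "p \<in> loops_at S x" and "A = path_class S p"
      using \<open>A \<in> carrier ?G\<close> by (auto simp: carrier_fundamental_group)
    moreover from p have "path_class S (reversepath p +++ p) = path_class S (\<lambda>_. x)"
      by (intro path_class_eqI homotopic_paths_reversepath_join) (auto simp: loops_at_iff)
    ultimately show ?thesis
      by (intro bexI[of _ "path_class S (reversepath p)"])
         (auto simp: one_fundamental_group mult_fundamental_group path_class_in_fundamental_group loops_at_reversepath)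
  qed
qed

text \<open>If \<open>\<gamma>\<close> and \<open>\<delta>\<close> lead from a base point to the two
  ends of \<open>p\<close>, this closes \<open>p\<close> up to a loop. Equal paths
  \<open>\<gamma>\<close> and \<open>\<delta>\<close> give the change of base point. Allowing them
  to differ lets the same facts serve the induced automorphisms and the extension of a
  representation to paths.\<close>

definition transport_path :: "(real \<Rightarrow> 'a::topological_space) \<Rightarrow> (real \<Rightarrow> 'a) \<Rightarrow> (real \<Rightarrow> 'a) \<Rightarrow> real \<Rightarrow> 'a" where
  "transport_path \<gamma> \<delta> p = \<gamma> +++ (p +++ reversepath \<delta>)"

abbreviation conj_path :: "(real \<Rightarrow> 'a::topological_space) \<Rightarrow> (real \<Rightarrow> 'a) \<Rightarrow> real \<Rightarrow> 'a" where
  "conj_path \<gamma> \<equiv> transport_path \<gamma> \<gamma>"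

lemma conj_path_in_loops_at:
  assumes "path \<gamma>" "path_image \<gamma> \<subseteq> S" "p \<in> loops_at S (pathfinish \<gamma>)"
  shows "conj_path \<gamma> p \<in> loops_at S (pathstart \<gamma>)"
  using assms by (auto simp: transport_path_def loops_at_iff subset_path_image_join)

lemma homotopic_paths_transport_path:
  assumes "homotopic_paths S p q" "path \<gamma>" "path_image \<gamma> \<subseteq> S" "path \<delta>" "path_image \<delta> \<subseteq> S"
    and "pathfinish \<gamma> = pathstart p" "pathfinish p = pathfinish \<delta>"
  shows "homotopic_paths S (transport_path \<gamma> \<delta> p) (transport_path \<gamma> \<delta> q)"
  using assms unfolding transport_path_def
  by (intro homotopic_paths_join) auto

text \<open>The return along \<open>\<delta>\<close> cancels against the next departure along
  \<open>\<delta>\<close>. This makes both the induced automorphism and the extension to paths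
  multiplicative.\<close>

lemma homotopic_paths_transport_path_join:
  assumes \<gamma>: "path \<gamma>" "path_image \<gamma> \<subseteq> S" and \<delta>: "path \<delta>" "path_image \<delta> \<subseteq> S" and \<epsilon>: "path \<epsilon>" "path_image \<epsilon> \<subseteq> S"
    and p: "path p" "path_image p \<subseteq> S" "pathstart p = pathfinish \<gamma>" "pathfinish p = pathfinish \<delta>"
    and q: "path q" "path_image q \<subseteq> S" "pathstart q = pathfinish \<delta>" "pathfinish q = pathfinish \<epsilon>"
    and start: "pathstart \<delta> = pathstart \<gamma>"
  shows "homotopic_paths S (transport_path \<gamma> \<delta> p +++ transport_path \<delta> \<epsilon> q) (transport_path \<gamma> \<epsilon> (p +++ q))"
proof -
  \<comment> \<open>Here \<open>\<delta>\<close> is written as a double reverse, so that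
    \<open>homotopic_paths_cancel_middle\<close> applies with \<open>reversepath \<delta>\<close> as
    the cancelled path.\<close>
  have "homotopic_paths S (transport_path \<gamma> \<delta> p +++ transport_path \<delta> \<epsilon> q)
      (((\<gamma> +++ p) +++ reversepath \<delta>) +++ (reversepath (reversepath \<delta>) +++ (q +++ reversepath \<epsilon>)))"
    unfolding transport_path_def reversepath_reversepath
    using assms by (intro homotopic_paths_join[OF homotopic_paths_assoc]) (auto simp: subset_path_image_join)
  also have "homotopic_paths S \<dots> ((\<gamma> +++ p) +++ (q +++ reversepath \<epsilon>))"
    using assms by (intro homotopic_paths_cancel_middle) (auto simp: subset_path_image_join)
  also have "homotopic_paths S \<dots> (\<gamma> +++ (p +++ (q +++ reversepath \<epsilon>)))"
    using assms by (intro homotopic_paths_assoc[THEN homotopic_paths_sym]) (auto simp: subset_path_image_join)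
  also have "homotopic_paths S \<dots> (transport_path \<gamma> \<epsilon> (p +++ q))"
    unfolding transport_path_def
    using assms by (intro homotopic_paths_join[OF _ homotopic_paths_assoc]) (auto simp: subset_path_image_join)
  finally show ?thesis .
qed

text \<open>Changes of base point along \<open>\<gamma>\<close> and along its reverse undo each
  other. This direction yields surjectivity of the induced automorphism; applied to the reverse of
  \<open>\<gamma>\<close> it yields injectivity.\<close>

lemma homotopic_paths_conj_path_reversepath:
  assumes \<gamma>: "path \<gamma>" "path_image \<gamma> \<subseteq> S" and p: "p \<in> loops_at S (pathstart \<gamma>)"
  shows "homotopic_paths S (conj_path \<gamma> (conj_path (reversepath \<gamma>) p)) p"
proof -
  note pq = p[unfolded loops_at_iff] \<gamma>
  have "homotopic_paths S (conj_path \<gamma> (conj_path (reversepath \<gamma>) p)) (\<gamma> +++ (reversepath \<gamma> +++ ((p +++ \<gamma>) +++ reversepath \<gamma>)))"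
    unfolding transport_path_def reversepath_reversepath
    using pq by (intro homotopic_paths_join[OF _ homotopic_paths_assoc[THEN homotopic_paths_sym]]) (auto simp: subset_path_image_join)
  also have "homotopic_paths S \<dots> ((\<gamma> +++ reversepath \<gamma>) +++ ((p +++ \<gamma>) +++ reversepath \<gamma>))"
    using pq by (intro homotopic_paths_assoc) (auto simp: subset_path_image_join)
  also have "homotopic_paths S \<dots> ((\<lambda>_. pathstart \<gamma>) +++ ((p +++ \<gamma>) +++ reversepath \<gamma>))"
    using pq by (intro homotopic_paths_join homotopic_paths_join_reversepath) (auto simp: subset_path_image_join)
  also have "homotopic_paths S \<dots> ((p +++ \<gamma>) +++ reversepath \<gamma>)"
    using pq by (intro homotopic_paths_const_left) (auto simp: subset_path_image_join)
  also have "homotopic_paths S \<dots> (p +++ (\<gamma> +++ reversepath \<gamma>))"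
    using pq by (intro homotopic_paths_assoc[THEN homotopic_paths_sym]) (auto simp: subset_path_image_join)
  also have "homotopic_paths S \<dots> (p +++ (\<lambda>_. pathstart \<gamma>))"
    using pq by (intro homotopic_paths_join homotopic_paths_join_reversepath) (auto simp: subset_path_image_join)
  also have "homotopic_paths S \<dots> p"
    using pq by (intro homotopic_paths_const_right) (auto simp: subset_path_image_join)
  finally show ?thesis .
qed

lemma homotopic_paths_conj_pathD:
  assumes \<gamma>: "path \<gamma>" "path_image \<gamma> \<subseteq> S"
    and p: "p \<in> loops_at S (pathfinish \<gamma>)" and q: "q \<in> loops_at S (pathfinish \<gamma>)"
    and "homotopic_paths S (conj_path \<gamma> p) (conj_path \<gamma> q)"
  shows "homotopic_paths S p q"
proof -
  have back_homotopic: "homotopic_paths S (conj_path (reversepath \<gamma>) (conj_path \<gamma> r)) r"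
    if "r \<in> loops_at S (pathfinish \<gamma>)" for r
    using homotopic_paths_conj_path_reversepath[of "reversepath \<gamma>" S r] that \<gamma> by simp
  have "homotopic_paths S (conj_path (reversepath \<gamma>) (conj_path \<gamma> p)) (conj_path (reversepath \<gamma>) (conj_path \<gamma> q))"
    using \<gamma> conj_path_in_loops_at[OF \<gamma> p]
    by (intro homotopic_paths_transport_path[OF assms(5)]) (simp_all add: loops_at_iff)
  from homotopic_paths_trans[OF homotopic_paths_trans[OF homotopic_paths_sym[OF back_homotopic[OF p]] this] back_homotopic[OF q]]
  show ?thesis .
qed

lemma loops_at_compose:
  assumes "p \<in> loops_at S x" "continuous_on S f" "f ` S \<subseteq> S"
  shows "f \<circ> p \<in> loops_at S (f x)"
  using assms
  by (auto simp: loops_at_iff path_image_compose pathstart_compose pathfinish_compose 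
      intro!: path_continuous_image continuous_on_subset[of S f])

lemma induced_auto_path_class:
  assumes f: "continuous_on S f" "f ` S \<subseteq> S"
    and \<gamma>: "path \<gamma>" "path_image \<gamma> \<subseteq> S" "pathstart \<gamma> = x" "pathfinish \<gamma> = f x"
    and p: "p \<in> loops_at S x"
  shows "induced_auto S x f \<gamma> (path_class S p) = path_class S (conj_path \<gamma> (f \<circ> p))"
proof -
  have "(\<Union>q\<in>path_class S p. path_class S (conj_path \<gamma> (f \<circ> q))) = path_class S (conj_path \<gamma> (f \<circ> p))"
  proof (rule UN_path_class)
    show "path_class S (conj_path \<gamma> (f \<circ> q)) = path_class S (conj_path \<gamma> (f \<circ> p))"
      if "homotopic_paths S p q" for q
    proof -
      have "homotopic_paths S (f \<circ> p) (f \<circ> q)"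
        using that f by (auto intro: homotopic_paths_continuous_image)
      with \<gamma> have "homotopic_paths S (conj_path \<gamma> (f \<circ> p)) (conj_path \<gamma> (f \<circ> q))"
        using loops_at_compose[OF p f]
        by (intro homotopic_paths_transport_path) (auto simp: loops_at_iff)
      then show ?thesis
        by (simp add: path_class_eqI)
    qed
  qed (use p in \<open>auto simp: loops_at_iff\<close>)
  then show ?thesis
    using p by (simp add: induced_auto_def transport_path_def path_class_in_fundamental_group)
qed

text \<open>The action uses the inverse in \<open>AutoGroup\<close>, which is the inverse map only
  for genuine automorphisms. Both ingredients are invertible: \<open>f\<close> through
  \<open>f'\<close>, and the change of base point through the reverse of
  \<open>\<gamma>\<close>.\<close>

lemma induced_auto_in_auto:
  assumes hom: "homeomorphism S S f f'"
    and \<gamma>: "path \<gamma>" "path_image \<gamma> \<subseteq> S" "pathstart \<gamma> = x" "pathfinish \<gamma> = f x"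
  shows "induced_auto S x f \<gamma> \<in> auto (fundamental_group S x)"
proof -
  let ?G = "fundamental_group S x" and ?a = "induced_auto S x f \<gamma>"
  have f: "continuous_on S f" "f ` S \<subseteq> S" and f': "continuous_on S f'" "f' ` S \<subseteq> S"
    and ff': "\<And>y. y \<in> S \<Longrightarrow> f (f' y) = y" and f'f: "\<And>y. y \<in> S \<Longrightarrow> f' (f y) = y"
    using hom by (auto simp: homeomorphism_def)
  have "x \<in> S"
    using \<gamma> by (metis pathstart_in_path_image subsetD)
  note a = induced_auto_path_class[OF f \<gamma>]
  note fp = loops_at_compose[OF _ f]
  have conj_loop: "conj_path \<gamma> (f \<circ> p) \<in> loops_at S x" if "p \<in> loops_at S x" for p
    using conj_path_in_loops_at[OF \<gamma>(1,2), of "f \<circ> p"] fp[OF that] \<gamma> by simp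
  have "?a \<in> hom ?G ?G"
  proof (rule homI)
    show "?a A \<in> carrier ?G" if "A \<in> carrier ?G" for A
      using that conj_loop by (auto simp: carrier_fundamental_group a)
    show "?a (A \<otimes>\<^bsub>?G\<^esub> B) = ?a A \<otimes>\<^bsub>?G\<^esub> ?a B" if AB: "A \<in> carrier ?G" "B \<in> carrier ?G" for A B
    proof -
      obtain p q where pq: "p \<in> loops_at S x" "q \<in> loops_at S x" and "A = path_class S p" "B = path_class S q"
        using AB by (auto simp: carrier_fundamental_group)
      moreover have "homotopic_paths S (conj_path \<gamma> (f \<circ> p) +++ conj_path \<gamma> (f \<circ> q)) (conj_path \<gamma> (f \<circ> (p +++ q)))"
        unfolding path_compose_join
        using fp[OF pq(1)] fp[OF pq(2)] \<gamma> by (intro homotopic_paths_transport_path_join) (auto simp: loops_at_iff)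
      ultimately show ?thesis
        by (simp add: mult_fundamental_group a loops_at_join conj_loop path_class_eqI)
    qed
  qed
  moreover have "bij_betw ?a (carrier ?G) (carrier ?G)"
  proof (rule bij_betw_imageI)
    show "inj_on ?a (carrier ?G)"
    proof (rule inj_onI)
      fix A B assume AB: "A \<in> carrier ?G" "B \<in> carrier ?G" and "?a A = ?a B"
      then obtain p q where pq: "p \<in> loops_at S x" "q \<in> loops_at S x" and AB_eq: "A = path_class S p" "B = path_class S q"
        by (auto simp: carrier_fundamental_group)
      with \<open>?a A = ?a B\<close> have "homotopic_paths S (conj_path \<gamma> (f \<circ> p)) (conj_path \<gamma> (f \<circ> q))"
        using conj_loop by (simp add: a path_class_eq_iff loops_at_iff)
      then have "homotopic_paths S (f \<circ> p) (f \<circ> q)"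
        by (rule homotopic_paths_conj_pathD[OF \<gamma>(1,2), rotated 2]) (use \<gamma> fp pq in simp_all)
      then have *: "homotopic_paths S (f' \<circ> (f \<circ> p)) (f' \<circ> (f \<circ> q))"
        using f' by (auto intro: homotopic_paths_continuous_image)
      \<comment> \<open>The maps \<open>f'\<close> and \<open>f\<close> cancel only on
        \<open>S\<close>, and \<open>r\<close> may leave \<open>S\<close> outside the unit interval.
        So this is a homotopy and not an equation.\<close>
      have back_homotopic: "homotopic_paths S r (f' \<circ> (f \<circ> r))" if "r \<in> loops_at S x" for r
        using that f'f by (intro homotopic_paths_eq) (auto simp: loops_at_iff path_image_def image_subset_iff)
      have "homotopic_paths S p q"
        using homotopic_paths_trans[OF homotopic_paths_trans[OF back_homotopic[OF pq(1)] *]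
            homotopic_paths_sym[OF back_homotopic[OF pq(2)]]] .
      then show "A = B"
        by (simp add: AB_eq path_class_eqI)
    qed
    have "A \<in> ?a ` carrier ?G" if "A \<in> carrier ?G" for A
    proof -
      obtain q where q: "q \<in> loops_at S x" and A: "A = path_class S q"
        using \<open>A \<in> carrier ?G\<close> by (auto simp: carrier_fundamental_group)
      \<comment> \<open>A preimage of the class of \<open>q\<close> is found by undoing the two
        steps in reverse order: \<open>u\<close> carries \<open>q\<close> back to the base point
        \<open>f x\<close>, and \<open>f'\<close> then returns it to \<open>x\<close>.\<close>
      define u where "u = conj_path (reversepath \<gamma>) q"
      have u: "u \<in> loops_at S (f x)"
        using conj_path_in_loops_at[of "reversepath \<gamma>" S q] \<gamma> q by (simp add: u_def)
      have f'u: "f' \<circ> u \<in> loops_at S x"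
        using loops_at_compose[OF u f'] f'f \<open>x \<in> S\<close> by simp
      have "homotopic_paths S u (f \<circ> (f' \<circ> u))"
        using u ff' by (intro homotopic_paths_eq) (auto simp: loops_at_iff path_image_def image_subset_iff)
      then have "homotopic_paths S (conj_path \<gamma> u) (conj_path \<gamma> (f \<circ> (f' \<circ> u)))"
        using \<gamma> u by (intro homotopic_paths_transport_path) (auto simp: loops_at_iff)
      moreover have "homotopic_paths S (conj_path \<gamma> u) q"
        unfolding u_def using \<gamma> q by (intro homotopic_paths_conj_path_reversepath) auto
      ultimately have "homotopic_paths S q (conj_path \<gamma> (f \<circ> (f' \<circ> u)))"
        using homotopic_paths_sym homotopic_paths_trans by blast
      then have "A = ?a (path_class S (f' \<circ> u))"
        by (simp add: A a f'u path_class_eqI)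
      then show ?thesis
        using f'u path_class_in_fundamental_group by blast
    qed
    with \<open>?a \<in> hom ?G ?G\<close> show "?a ` carrier ?G = carrier ?G"
      by (auto simp: hom_def)
  qed
  ultimately show ?thesis
    by (simp add: auto_def Bij_def induced_auto_def)
qed

section \<open>Paths and singular simplices\<close>

definition edge_point :: "real \<Rightarrow> nat \<Rightarrow> real" where
  "edge_point t = (\<lambda>i. if i = 0 then 1 - t else if i = 1 then t else 0)"

text \<open>The pair consists of the barycentric coordinates at the vertices 1 and 2. It replaces
  the standard 2-simplex by a triangle in the plane, a normed space in which convexity gives simple
  connectedness.\<close>

definition triangle_point :: "real \<times> real \<Rightarrow> nat \<Rightarrow> real" where
  "triangle_point = (\<lambda>(a, b) i. if i = 0 then 1 - a - b else if i = 1 then a else if i = 2 then b else 0)"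

definition path_of_simplex :: "((nat \<Rightarrow> real) \<Rightarrow> 'a) \<Rightarrow> real \<Rightarrow> 'a" where
  "path_of_simplex \<sigma> = \<sigma> \<circ> edge_point"

text \<open>Coordinate 1 recovers the parameter of \<open>edge_point\<close>. The restriction is
  there because singular simplices are extensional functions.\<close>

definition simplex_of_path :: "(real \<Rightarrow> 'a) \<Rightarrow> (nat \<Rightarrow> real) \<Rightarrow> 'a" where
  "simplex_of_path p = restrict (\<lambda>v. p (v 1)) (standard_simplex 1)"

lemma edge_point_in_standard_simplex: "t \<in> {0..1} \<Longrightarrow> edge_point t \<in> standard_simplex 1"
  by (auto simp: standard_simplex_def edge_point_def)

lemma continuous_map_edge_point:
  "continuous_map (top_of_set {0..1}) (subtopology (powertop_real UNIV) (standard_simplex 1)) edge_point"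
proof -
  have "continuous_on {0..1} (\<lambda>t. edge_point t i)" for i
    by (cases "i = 0"; cases "i = 1") (auto simp: edge_point_def intro!: continuous_intros)
  then show ?thesis
    using edge_point_in_standard_simplex
    by (auto simp: continuous_map_in_subtopology continuous_map_componentwise_UNIV)
qed

lemma convex_triangle: "convex {(a, b). 0 \<le> a \<and> 0 \<le> b \<and> a + b \<le> (1::real)}"
proof -
  have "{(a, b). 0 \<le> a \<and> 0 \<le> b \<and> a + b \<le> (1::real)} =
      {z. 0 \<le> (1, 0) \<bullet> z} \<inter> {z. 0 \<le> (0, 1) \<bullet> z} \<inter> {z. (1, 1) \<bullet> z \<le> (1::real)}"
    by (auto simp: inner_prod_def)
  also have "convex \<dots>"
    using convex_halfspace_ge[of 0] by (intro convex_Int convex_halfspace_le) auto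
  finally show ?thesis .
qed

lemma continuous_map_triangle_point:
  "continuous_map (top_of_set {(a, b). 0 \<le> a \<and> 0 \<le> b \<and> a + b \<le> 1})
     (subtopology (powertop_real UNIV) (standard_simplex 2)) triangle_point"
proof -
  have "triangle_point z \<in> standard_simplex 2" if "z \<in> {(a, b). 0 \<le> a \<and> 0 \<le> b \<and> a + b \<le> 1}" for z
    using that by (auto simp: standard_simplex_def triangle_point_def numeral_2_eq_2)
  moreover have "continuous_on {(a, b). 0 \<le> a \<and> 0 \<le> b \<and> a + b \<le> 1} (\<lambda>z. triangle_point z i)" for i
    by (cases "i = 0"; cases "i = 1"; cases "i = 2")
       (auto simp: triangle_point_def case_prod_unfold intro!: continuous_intros)
  ultimately show ?thesis
    by (auto simp: continuous_map_in_subtopology continuous_map_componentwise_UNIV)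
qed

lemma path_path_of_simplex:
  assumes "singular_simplex 1 (top_of_set S) \<sigma>"
  shows "path (path_of_simplex \<sigma>)" "path_image (path_of_simplex \<sigma>) \<subseteq> S"
proof -
  have "continuous_map (top_of_set {0..1}) (top_of_set S) (path_of_simplex \<sigma>)"
    unfolding path_of_simplex_def
    using assms unfolding singular_simplex_def
    by (intro continuous_map_compose[OF continuous_map_edge_point]) blast
  then show "path (path_of_simplex \<sigma>)" "path_image (path_of_simplex \<sigma>) \<subseteq> S"
    by (auto simp: path_def path_image_def)
qed

lemma singular_simplex_simplex_of_path:
  assumes "path p" "path_image p \<subseteq> S"
  shows "singular_simplex 1 (top_of_set S) (simplex_of_path p)"
proof -
  have "continuous_map (subtopology (powertop_real UNIV) (standard_simplex 1)) (top_of_set {0..1}) (\<lambda>v. v 1)"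
    by (auto simp: continuous_map_in_subtopology standard_simplex_def
        intro!: continuous_map_from_subtopology continuous_map_product_projection)
  moreover have "continuous_map (top_of_set {0..1}) (top_of_set S) p"
    using assms by (auto simp: path_def path_image_def)
  ultimately have "continuous_map (subtopology (powertop_real UNIV) (standard_simplex 1)) (top_of_set S) (p \<circ> (\<lambda>v. v 1))"
    by (rule continuous_map_compose)
  then show ?thesis
    by (auto simp: singular_simplex_def simplex_of_path_def intro: continuous_map_eq)
qed

lemma path_of_simplex_of_path: "t \<in> {0..1} \<Longrightarrow> path_of_simplex (simplex_of_path p) t = p t"
  using edge_point_in_standard_simplex[of t]
  by (simp add: path_of_simplex_def simplex_of_path_def edge_point_def)

text \<open>The face map of index k inserts a zero at coordinate k. Faces 2, 0 and 1 therefore run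
  from vertex 0 to 1, from 1 to 2, and from 0 to 2.\<close>

lemma path_of_singular_face:
  assumes "t \<in> {0..1}"
  shows "path_of_simplex (singular_face 2 2 \<tau>) t = (\<tau> \<circ> triangle_point) (t, 0)"
    and "path_of_simplex (singular_face 2 1 \<tau>) t = (\<tau> \<circ> triangle_point) (0, t)"
    and "path_of_simplex (singular_face 2 0 \<tau>) t = (\<tau> \<circ> triangle_point) (1 - t, t)"
proof -
  have "simplical_face 2 (edge_point t) = triangle_point (t, 0)"
    "simplical_face 1 (edge_point t) = triangle_point (0, t)"
    "simplical_face 0 (edge_point t) = triangle_point (1 - t, t)"
    by (rule ext, force simp: simplical_face_def edge_point_def triangle_point_def)+
  then show "path_of_simplex (singular_face 2 2 \<tau>) t = (\<tau> \<circ> triangle_point) (t, 0)"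
    and "path_of_simplex (singular_face 2 1 \<tau>) t = (\<tau> \<circ> triangle_point) (0, t)"
    and "path_of_simplex (singular_face 2 0 \<tau>) t = (\<tau> \<circ> triangle_point) (1 - t, t)"
    using edge_point_in_standard_simplex[OF assms]
    by (simp_all add: path_of_simplex_def singular_face_def)
qed

text \<open>The planar triangle is simply connected, so two of its edges in succession are homotopic
  in it to the third, and \<open>\<tau>\<close> carries the homotopy into \<open>S\<close>. This is
  the geometric source of the cocycle identity.\<close>

lemma homotopic_paths_triangle:
  assumes "singular_simplex 2 (top_of_set S) \<tau>"
  shows "homotopic_paths S (path_of_simplex (singular_face 2 2 \<tau>) +++ path_of_simplex (singular_face 2 0 \<tau>))
           (path_of_simplex (singular_face 2 1 \<tau>))"
    and "pathfinish (path_of_simplex (singular_face 2 2 \<tau>)) = pathstart (path_of_simplex (singular_face 2 0 \<tau>))"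
proof -
  define T where "T = {(a, b). 0 \<le> a \<and> 0 \<le> b \<and> a + b \<le> (1::real)}"
  define p q r where "p = linepath (0::real, 0::real) (1, 0)" and "q = linepath (1::real, 0::real) (0, 1)"
    and "r = linepath (0::real, 0::real) (0, 1)"
  have "continuous_map (top_of_set T) (top_of_set S) (\<tau> \<circ> triangle_point)"
    using assms unfolding T_def
    unfolding singular_simplex_def
    by (intro continuous_map_compose[OF continuous_map_triangle_point]) blast
  then have cont: "continuous_on T (\<tau> \<circ> triangle_point)" "\<tau> \<circ> triangle_point \<in> T \<rightarrow> S"
    by auto
  have pqr: "path_image p \<subseteq> T" "path_image q \<subseteq> T" "path_image r \<subseteq> T"
    using convex_triangle unfolding T_def p_def q_def r_def path_image_linepath
    by (intro closed_segment_subset; simp)+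
  have "simply_connected T"
    unfolding T_def by (rule convex_imp_simply_connected[OF convex_triangle])
  then have "homotopic_paths T (p +++ q) r"
    using pqr by (simp add: simply_connected_eq_homotopic_paths subset_path_image_join p_def q_def r_def)
  then have "homotopic_paths S ((\<tau> \<circ> triangle_point) \<circ> (p +++ q)) ((\<tau> \<circ> triangle_point) \<circ> r)"
    using cont by (rule homotopic_paths_continuous_image)
  then have *: "homotopic_paths S (((\<tau> \<circ> triangle_point) \<circ> p) +++ ((\<tau> \<circ> triangle_point) \<circ> q)) ((\<tau> \<circ> triangle_point) \<circ> r)"
    by (simp add: path_compose_join)
  have faces: "path_of_simplex (singular_face 2 2 \<tau>) t = ((\<tau> \<circ> triangle_point) \<circ> p) t"
    "path_of_simplex (singular_face 2 0 \<tau>) t = ((\<tau> \<circ> triangle_point) \<circ> q) t"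
    "path_of_simplex (singular_face 2 1 \<tau>) t = ((\<tau> \<circ> triangle_point) \<circ> r) t" if "t \<in> {0..1}" for t
    using path_of_singular_face[OF that, of \<tau>] by (simp_all add: p_def q_def r_def linepath_def)
  have sf: "singular_simplex 1 (top_of_set S) (singular_face 2 k \<tau>)" if "k \<le> 2" for k
    using singular_simplex_singular_face[OF assms, of k] that by simp
  show fin: "pathfinish (path_of_simplex (singular_face 2 2 \<tau>)) = pathstart (path_of_simplex (singular_face 2 0 \<tau>))"
    using faces[of 1] faces[of 0] by (simp add: pathstart_def pathfinish_def p_def q_def linepath_def)
  have eq: "homotopic_paths S (path_of_simplex (singular_face 2 2 \<tau>)) ((\<tau> \<circ> triangle_point) \<circ> p)"
    "homotopic_paths S (path_of_simplex (singular_face 2 0 \<tau>)) ((\<tau> \<circ> triangle_point) \<circ> q)"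
    "homotopic_paths S (path_of_simplex (singular_face 2 1 \<tau>)) ((\<tau> \<circ> triangle_point) \<circ> r)"
    by (rule homotopic_paths_eq[OF path_path_of_simplex[OF sf]]; simp add: faces del: One_nat_def)+
  show "homotopic_paths S (path_of_simplex (singular_face 2 2 \<tau>) +++ path_of_simplex (singular_face 2 0 \<tau>))
           (path_of_simplex (singular_face 2 1 \<tau>))"
    using homotopic_paths_trans[OF homotopic_paths_trans[OF homotopic_paths_join[OF eq(1,2) fin] *] homotopic_paths_sym[OF eq(3)]] .
qed

text \<open>The injectivity half of Hurewicz's theorem in dual form: \<open>E\<close> is a cocycle, hence factors through \<open>H\<^sub>1\<close>.\<close>

lemma (in comm_group) homologous_paths_invariant:
  fixes E :: "(real \<Rightarrow> 'c::topological_space) \<Rightarrow> 'a"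
  assumes closed: "\<And>p. \<lbrakk>path p; path_image p \<subseteq> S\<rbrakk> \<Longrightarrow> E p \<in> carrier G"
    and homotopic: "\<And>p q. homotopic_paths S p q \<Longrightarrow> E p = E q"
    and join: "\<And>p q. \<lbrakk>path p; path_image p \<subseteq> S; path q; path_image q \<subseteq> S; pathfinish p = pathstart q\<rbrakk>
                 \<Longrightarrow> E (p +++ q) = E p \<otimes> E q"
    and p: "path p" "path_image p \<subseteq> S" and q: "path q" "path_image q \<subseteq> S"
    and homologous: "homologous_rel 1 (top_of_set S) {} (frag_of (simplex_of_path p)) (frag_of (simplex_of_path q))"
  shows "E p = E q"
proof -
  let ?X = "top_of_set S"
  let ?C = "free_Abelian_group (singular_simplex_set 1 ?X)"
  have "(\<lambda>\<sigma>. E (path_of_simplex \<sigma>)) ` singular_simplex_set 1 ?X \<subseteq> carrier G"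
    using closed path_path_of_simplex by blast
  \<comment> \<open>Commutativity of \<open>G\<close> enters here: the values of \<open>E\<close> on
    1-simplices extend to a homomorphism on chains by the universal property of free abelian
    groups.\<close>
  then obtain h where h: "h \<in> hom ?C G"
    and h_of: "\<And>\<sigma>. singular_simplex 1 ?X \<sigma> \<Longrightarrow> h (frag_of \<sigma>) = E (path_of_simplex \<sigma>)"
    using free_Abelian_group_universal[of "\<lambda>\<sigma>. E (path_of_simplex \<sigma>)" "singular_simplex_set 1 ?X"] by auto
  interpret h: group_hom ?C G h
    using h group_free_Abelian_group is_group by (simp add: group_hom_def group_hom_axioms_def)
  have h_diff: "h (a - b) = h a \<otimes> inv h b" if "singular_chain 1 ?X a" "singular_chain 1 ?X b" for a b
  proof -
    have "h (a + - b) = h a \<otimes> inv h b"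
      using that h.hom_mult[of a "- b"] h.hom_inv[of b] by (simp add: singular_chain_def)
    then show ?thesis by simp
  qed
  \<comment> \<open>The induction builds 2-chains from generators by differences, so the cocycle
    identity has to be checked only on single triangles.\<close>
  have boundary: "h (chain_boundary 2 d) = \<one>" if "singular_chain 2 ?X d" for d
    using that unfolding singular_chain_def
  proof (rule free_Abelian_group_induct)
    show "h (chain_boundary 2 0) = \<one>"
      using h.hom_one by simp
  next
    fix x y
    assume xy: "Poly_Mapping.keys x \<subseteq> singular_simplex_set 2 ?X" "Poly_Mapping.keys y \<subseteq> singular_simplex_set 2 ?X"
      "h (chain_boundary 2 x) = \<one>" "h (chain_boundary 2 y) = \<one>"
    then have "singular_chain 2 ?X x" "singular_chain 2 ?X y"
      by (simp_all add: singular_chain_def)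
    then have "singular_chain 1 ?X (chain_boundary 2 x)" "singular_chain 1 ?X (chain_boundary 2 y)"
      using singular_chain_boundary[of 2 ?X] by auto
    with xy show "h (chain_boundary 2 (x - y)) = \<one>"
      by (simp add: chain_boundary_diff h_diff)
  next
    fix \<tau> assume "\<tau> \<in> singular_simplex_set 2 ?X"
    then have \<tau>: "singular_simplex 2 ?X \<tau>" by simp
    let ?f = "\<lambda>k. singular_face 2 k \<tau>"
    have sf: "singular_simplex 1 ?X (?f k)" if "k \<le> 2" for k
      using singular_simplex_singular_face[OF \<tau>, of k] that by simp
    have sc: "singular_chain 1 ?X (frag_of (?f k))" if "k \<le> 2" for k
      using sf[OF that] by (simp add: singular_chain_of)
    \<comment> \<open>The boundary signs are plus, minus, plus. The two positive faces are put in
      the order in which they join as paths, 2 before 0, to match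
      \<open>homotopic_paths_triangle\<close>.\<close>
    have "chain_boundary 2 (frag_of \<tau>) = (frag_of (?f 2) + frag_of (?f 0)) - frag_of (?f 1)"
      by (simp add: chain_boundary_of numeral_2_eq_2)
    then have "h (chain_boundary 2 (frag_of \<tau>)) = h (frag_of (?f 2) + frag_of (?f 0)) \<otimes> inv h (frag_of (?f 1))"
      using sc by (simp add: h_diff singular_chain_add)
    also have "h (frag_of (?f 2) + frag_of (?f 0)) = E (path_of_simplex (?f 2)) \<otimes> E (path_of_simplex (?f 0))"
      using h.hom_mult[of "frag_of (?f 2)" "frag_of (?f 0)"] sf by (simp add: h_of)
    also have "\<dots> = E (path_of_simplex (?f 1))"
      using homotopic_paths_triangle[OF \<tau>] path_path_of_simplex[OF sf] join homotopic by (metis order_refl zero_le)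
    finally show "h (chain_boundary 2 (frag_of \<tau>)) = \<one>"
      using closed path_path_of_simplex[OF sf] sf by (simp add: h_of)
  qed
  let ?p = "frag_of (simplex_of_path p)" and ?q = "frag_of (simplex_of_path q)"
  have chains: "singular_chain 1 ?X ?p" "singular_chain 1 ?X ?q"
    using p q singular_simplex_simplex_of_path by (simp_all add: singular_chain_of)
  obtain d where "singular_chain 2 ?X d" and "chain_boundary 2 d = ?p - ?q"
    using homologous by (auto simp: homologous_rel_def singular_boundary numeral_2_eq_2)
  then have "h ?p \<otimes> inv h ?q = \<one>"
    using boundary h_diff[OF chains] by metis
  moreover have "h ?p = E (path_of_simplex (simplex_of_path p))" "h ?q = E (path_of_simplex (simplex_of_path q))"
    using h_of[OF singular_simplex_simplex_of_path[OF p]] h_of[OF singular_simplex_simplex_of_path[OF q]] .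
  \<comment> \<open>Passing to a simplex and back preserves \<open>r\<close> only on the unit
    interval, so homotopy invariance of \<open>E\<close> is used.\<close>
  moreover have "E (path_of_simplex (simplex_of_path r)) = E r" if "path r" "path_image r \<subseteq> S" for r
    using homotopic[of r "path_of_simplex (simplex_of_path r)"] homotopic_paths_eq[OF that] path_of_simplex_of_path by metis
  ultimately show ?thesis
    using p q closed by (metis inv_closed inv_equality inv_inv)
qed

section \<open>Representations into abelian groups\<close>

text \<open>The base points of \<open>p\<close> and \<open>q\<close> may differ, as is needed for a
  homeomorphism that moves \<open>x\<close>. The conjugating path is harmless because its
  contributions cancel in a commutative group.\<close>

lemma (in comm_group) hom_fundamental_group_homologous:
  fixes S :: "'c::topological_space set"
  assumes S: "path_connected S" "x \<in> S" and \<rho>: "\<rho> \<in> hom (fundamental_group S x) G"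
    and p: "p \<in> loops_at S x" and q: "q \<in> loops_at S y"
    and \<gamma>: "path \<gamma>" "path_image \<gamma> \<subseteq> S" "pathstart \<gamma> = x" "pathfinish \<gamma> = y"
    and homologous: "homologous_rel 1 (top_of_set S) {} (frag_of (simplex_of_path q)) (frag_of (simplex_of_path p))"
  shows "\<rho> (path_class S (conj_path \<gamma> q)) = \<rho> (path_class S p)"
proof -
  let ?\<Pi> = "fundamental_group S x"
  interpret \<rho>: group_hom ?\<Pi> G \<rho>
    using \<rho> group_fundamental_group[OF \<open>x \<in> S\<close>] is_group by (simp add: group_hom_def group_hom_axioms_def)
  have "\<forall>z\<in>S. \<exists>\<eta>. path \<eta> \<and> path_image \<eta> \<subseteq> S \<and> pathstart \<eta> = x \<and> pathfinish \<eta> = z"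
    using S by (auto simp: path_connected_def)
  then obtain \<eta> where "\<forall>z\<in>S. path (\<eta> z) \<and> path_image (\<eta> z) \<subseteq> S \<and> pathstart (\<eta> z) = x \<and> pathfinish (\<eta> z) = z"
    by metis
  then have \<eta>: "path (\<eta> z)" "path_image (\<eta> z) \<subseteq> S" "pathstart (\<eta> z) = x" "pathfinish (\<eta> z) = z" if "z \<in> S" for z
    using that by blast+
  have ends: "pathstart r \<in> S" "pathfinish r \<in> S" if "path_image r \<subseteq> S" for r
    using that by auto
  \<comment> \<open>\<open>T\<close> closes a path up through the chosen \<open>\<eta>\<close>, and
    \<open>E\<close> is the resulting extension of \<open>\<rho>\<close>. The choice of
    \<open>\<eta>\<close> need not be continuous.\<close>
  define T where "T r = transport_path (\<eta> (pathstart r)) (\<eta> (pathfinish r)) r" for r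
  define E where "E r = \<rho> (path_class S (T r))" for r
  have T_loop: "T r \<in> loops_at S x" if "path r" "path_image r \<subseteq> S" for r
    using that \<eta>[OF ends(1)[OF that(2)]] \<eta>[OF ends(2)[OF that(2)]]
    by (auto simp: T_def transport_path_def loops_at_iff subset_path_image_join)
  have closed: "E r \<in> carrier G" if "path r" "path_image r \<subseteq> S" for r
    unfolding E_def using T_loop[OF that] by (intro \<rho>.hom_closed path_class_in_fundamental_group)
  have homotopic: "E r = E s" if "homotopic_paths S r s" for r s
  proof -
    have r: "path_image r \<subseteq> S"
      using homotopic_paths_imp_subset[OF that] by simp
    have "homotopic_paths S (T r) (T s)"
      using that \<eta>[OF ends(1)[OF r]] \<eta>[OF ends(2)[OF r]]
        homotopic_paths_imp_pathstart[OF that] homotopic_paths_imp_pathfinish[OF that]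
      unfolding T_def by (auto intro!: homotopic_paths_transport_path)
    then show ?thesis
      unfolding E_def by (simp add: path_class_eqI)
  qed
  have join: "E (r +++ s) = E r \<otimes> E s"
    if rs: "path r" "path_image r \<subseteq> S" "path s" "path_image s \<subseteq> S" "pathfinish r = pathstart s" for r s
  proof -
    have "homotopic_paths S (T r +++ T s) (T (r +++ s))"
      using rs \<eta>[OF ends(1)[OF rs(2)]] \<eta>[OF ends(2)[OF rs(2)]] \<eta>[OF ends(2)[OF rs(4)]]
      by (auto simp: T_def intro!: homotopic_paths_transport_path_join)
    then have "path_class S (T (r +++ s)) = path_class S (T r) \<otimes>\<^bsub>?\<Pi>\<^esub> path_class S (T s)"
      using T_loop rs by (simp add: mult_fundamental_group path_class_eqI)
    then show ?thesis
      using T_loop rs by (simp add: E_def path_class_in_fundamental_group)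
  qed
  have conj_loop: "E (conj_path \<delta> r) = E r"
    if \<delta>: "path \<delta>" "path_image \<delta> \<subseteq> S" and r: "r \<in> loops_at S (pathfinish \<delta>)" for \<delta> r
  proof -
    note r' = r[unfolded loops_at_iff]
    \<comment> \<open>A constant path is homotopic to its own square, so its value is idempotent and
      hence the unit. It follows that \<open>\<delta>\<close> and its reverse have inverse
      values.\<close>
    have "E (\<lambda>_. pathstart \<delta>) = E ((\<lambda>_. pathstart \<delta>) +++ (\<lambda>_. pathstart \<delta>))"
      using ends[OF \<delta>(2)]
      by (intro homotopic homotopic_paths_sym[OF homotopic_paths_const_left]) (auto simp: path_image_const_subset)
    also have "\<dots> = E (\<lambda>_. pathstart \<delta>) \<otimes> E (\<lambda>_. pathstart \<delta>)"
      using ends[OF \<delta>(2)] by (intro join) (auto simp: path_image_const_subset)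
    finally have "E (\<lambda>_. pathstart \<delta>) = \<one>"
      using ends[OF \<delta>(2)] closed[of "\<lambda>_. pathstart \<delta>"] by (simp add: path_image_const_subset)
    moreover have "E (\<lambda>_. pathstart \<delta>) = E (\<delta> +++ reversepath \<delta>)"
      using \<delta> by (intro homotopic homotopic_paths_sym[OF homotopic_paths_join_reversepath]) auto
    moreover have "E (\<delta> +++ reversepath \<delta>) = E \<delta> \<otimes> E (reversepath \<delta>)"
      using \<delta> by (intro join) auto
    ultimately have inverse: "E \<delta> \<otimes> E (reversepath \<delta>) = \<one>"
      by simp
    have "E (conj_path \<delta> r) = E \<delta> \<otimes> (E r \<otimes> E (reversepath \<delta>))"
      using \<delta> r' by (simp add: transport_path_def join subset_path_image_join)
    also have "\<dots> = E r \<otimes> (E \<delta> \<otimes> E (reversepath \<delta>))"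
      using \<delta> r' closed by (simp add: m_lcomm)
    finally show ?thesis
      using inverse closed r' by simp
  qed
  \<comment> \<open>The chosen \<open>\<eta> x\<close> is some loop, not necessarily constant. For
    loops at \<open>x\<close> the extension thus evaluates \<open>\<rho>\<close> on a conjugate, and
    commutativity removes the conjugation.\<close>
  have loop: "E r = \<rho> (path_class S r)" if r: "r \<in> loops_at S x" for r
  proof -
    have \<eta>_loops: "\<eta> x \<in> loops_at S x" "reversepath (\<eta> x) \<in> loops_at S x"
      using \<eta>[OF \<open>x \<in> S\<close>] by (auto simp: loops_at_iff)
    have "path_class S (\<eta> x) \<otimes>\<^bsub>?\<Pi>\<^esub> path_class S (reversepath (\<eta> x)) = \<one>\<^bsub>?\<Pi>\<^esub>"
      using \<eta>_loops \<eta>[OF \<open>x \<in> S\<close>]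
      by (auto simp: mult_fundamental_group one_fundamental_group intro!: path_class_eqI homotopic_paths_join_reversepath)
    then have inverse: "\<rho> (path_class S (\<eta> x)) \<otimes> \<rho> (path_class S (reversepath (\<eta> x))) = \<one>"
      using \<eta>_loops by (metis \<rho>.hom_mult \<rho>.hom_one path_class_in_fundamental_group)
    have "T r = \<eta> x +++ (r +++ reversepath (\<eta> x))"
      using r by (simp add: T_def transport_path_def loops_at_iff)
    then have "E r = \<rho> (path_class S (\<eta> x)) \<otimes> (\<rho> (path_class S r) \<otimes> \<rho> (path_class S (reversepath (\<eta> x))))"
      using r \<eta>_loops
      by (simp add: E_def loops_at_join path_class_in_fundamental_group flip: mult_fundamental_group)
    also have "\<dots> = \<rho> (path_class S r) \<otimes> (\<rho> (path_class S (\<eta> x)) \<otimes> \<rho> (path_class S (reversepath (\<eta> x))))"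
      using r \<eta>_loops by (simp add: m_lcomm path_class_in_fundamental_group)
    finally show ?thesis
      using inverse r by (simp add: path_class_in_fundamental_group)
  qed
  have "conj_path \<gamma> q \<in> loops_at S x"
    using conj_path_in_loops_at[of \<gamma> S q] \<gamma> q by simp
  then have "\<rho> (path_class S (conj_path \<gamma> q)) = E (conj_path \<gamma> q)"
    by (simp add: loop)
  also have "\<dots> = E q"
    using \<gamma> q by (intro conj_loop) auto
  also have "\<dots> = E p"
    using p q homologous unfolding loops_at_iff
    by (intro homologous_paths_invariant[where S = S and E = E, OF closed homotopic join]) auto
  also have "\<dots> = \<rho> (path_class S p)"
    using p by (rule loop)
  finally show ?thesis .
qed

section \<open>Loops as singular 1-cycles\<close>

lemma singular_relcycle_simplex_of_loop:
  assumes "path p" "path_image p \<subseteq> S" "pathfinish p = pathstart p"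
  shows "singular_relcycle 1 (top_of_set S) {} (frag_of (simplex_of_path p))"
proof -
  let ?\<sigma> = "simplex_of_path p"
  have "singular_face 1 0 ?\<sigma> = singular_face 1 1 ?\<sigma>"
  proof (rule ext)
    fix v
    show "singular_face 1 0 ?\<sigma> v = singular_face 1 1 ?\<sigma> v"
    proof (cases "v \<in> standard_simplex 0")
      case True
      then have "v 0 = 1"
        by (simp add: standard_simplex_def)
      moreover have "simplical_face 0 v \<in> standard_simplex 1" "simplical_face 1 v \<in> standard_simplex 1"
        using simplical_face_in_standard_simplex[of 1 _ v] True by simp_all
      \<comment> \<open>Face 0 evaluates the path at parameter 1 and face 1 at parameter 0. They
        coincide exactly because the path is closed.\<close>
      moreover have "simplical_face 0 v 1 = v 0" "simplical_face 1 v 1 = 0"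
        by (simp_all add: simplical_face_def)
      ultimately show ?thesis
        using True assms
        by (simp add: singular_face_def simplex_of_path_def pathstart_def pathfinish_def)
    qed (simp add: singular_face_def)
  qed
  then have "chain_boundary 1 (frag_of ?\<sigma>) = 0"
    by (simp add: chain_boundary_of)
  moreover have "singular_chain 1 (top_of_set S) (frag_of ?\<sigma>)"
    using singular_simplex_simplex_of_path[OF assms(1,2)] by (simp add: singular_chain_of)
  ultimately show ?thesis
    by (simp add: singular_cycle)
qed

lemma chain_map_simplex_of_path:
  "chain_map 1 f (frag_of (simplex_of_path p)) = frag_of (simplex_of_path (f \<circ> p))"
  unfolding chain_map_of simplex_map_def simplex_of_path_def
  by (intro arg_cong[where f = frag_of] ext) (simp add: restrict_def)

section \<open>Commutativity of the torus\<close>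

lemma comm_group_circle_group: "comm_group circle_group"
proof -
  have "\<exists>y\<in>sphere 0 1. y * x = 1" if "norm x = 1" for x :: complex
    using that by (intro bexI[of _ "inverse x"]) (auto simp: norm_inverse intro!: left_inverse)
  then show ?thesis
    by (intro comm_groupI) (auto simp: circle_group_def norm_mult)
qed

lemma comm_group_product_group:
  assumes "\<And>i. i \<in> I \<Longrightarrow> comm_group (G i)"
  shows "comm_group (product_group I G)"
proof (rule group.group_comm_groupI)
  show "group (product_group I G)"
    using assms by (simp add: comm_group.axioms(2))
  show "a \<otimes>\<^bsub>product_group I G\<^esub> b = b \<otimes>\<^bsub>product_group I G\<^esub> a"
    if "a \<in> carrier (product_group I G)" "b \<in> carrier (product_group I G)" for a b
    using that assms
    by (auto intro!: restrict_ext comm_monoid.m_comm[OF comm_group.axioms(1)])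
qed

lemma comm_group_torus_group: "comm_group (torus_group n)"
  unfolding torus_group_def by (intro comm_group_product_group comm_group_circle_group)

section \<open>Mapping classes and their action on homology\<close>

lemma mapping_class_memD:
  assumes "\<phi> \<in> carrier (mapping_class_group S)"
  obtains f where "f \<in> \<phi>" "\<And>h. h \<in> \<phi> \<Longrightarrow> (f, h) \<in> isotopic S"
proof -
  obtain f where f: "f \<in> carrier (homeo_group S)" and \<phi>: "\<phi> = isotopic S `` {f}"
    using assms by (auto simp: mapping_class_group_def quotient_def)
  have "(f, f) \<in> isotopic S"
    using f homeomorphic_imp_continuous_map[of "top_of_set S" "top_of_set S" f]
    by (auto simp: isotopic_def homeo_group_def)
  with \<phi> show thesis
    using that by auto
qed

text \<open>Isotopic homeomorphisms are homotopic and so induce the same map on homology. The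
  definite description in \<open>homology_rep\<close> therefore has a unique candidate, computed
  from any representative.\<close>

lemma homology_rep_eq:
  assumes \<phi>: "\<phi> \<in> carrier (mapping_class_group S)" and "f \<in> \<phi>"
  shows "homology_rep S \<phi> = restrict (hom_induced 1 (top_of_set S) {} (top_of_set S) {} f)
           (carrier (homology_group 1 (top_of_set S)))"
proof -
  obtain f0 where "f0 \<in> \<phi>" and f0: "\<And>h. h \<in> \<phi> \<Longrightarrow> (f0, h) \<in> isotopic S"
    using mapping_class_memD[OF \<phi>] by blast
  have "hom_induced 1 (top_of_set S) {} (top_of_set S) {} f0 = hom_induced 1 (top_of_set S) {} (top_of_set S) {} h"
    if "h \<in> \<phi>" for h
    using f0[OF that] unfolding isotopic_def
    by (intro homology_homotopy_empty) (auto elim: homotopic_with_mono)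
  with \<open>f \<in> \<phi>\<close> show ?thesis
    unfolding homology_rep_def by (intro the_equality) (metis, metis)
qed

lemma torelli_group_hom_induced:
  assumes "\<phi> \<in> torelli_group S" "f \<in> \<phi>" "c \<in> carrier (homology_group 1 (top_of_set S))"
  shows "hom_induced 1 (top_of_set S) {} (top_of_set S) {} f c = c"
proof -
  have "restrict (hom_induced 1 (top_of_set S) {} (top_of_set S) {} f) (carrier (homology_group 1 (top_of_set S)))
      = (\<lambda>c\<in>carrier (homology_group 1 (top_of_set S)). c)"
    using assms(1,2) homology_rep_eq[of \<phi> S f]
    by (simp add: torelli_group_def kernel_def AutoGroup_def BijGroup_def)
  with assms(3) show ?thesis
    by (metis restrict_apply')
qed

lemma mapping_class_homeomorphism:
  assumes "\<phi> \<in> carrier (mapping_class_group S)" "f \<in> \<phi>"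
  obtains f' where "homeomorphism S S f f'"
proof -
  have "f \<in> carrier (homeo_group S)"
    using assms mapping_class_memD[OF assms(1)] by (auto simp: isotopic_def)
  then have "homeomorphic_map (top_of_set S) (top_of_set S) f"
    by (simp add: homeo_group_def)
  then obtain f' where "homeomorphic_maps (top_of_set S) (top_of_set S) f f'"
    by (auto simp: homeomorphic_map_maps)
  then have "homeomorphism S S f f'"
    by (auto simp: homeomorphic_maps_def homeomorphism_def image_iff Pi_iff) metis+
  then show thesis ..
qed

text \<open>The automorphisms form a subgroup of the group of bijections, so the abstract inverse is
  the concrete one computed there.\<close>

lemma inv_AutoGroup:
  assumes "group G" "a \<in> auto G"
  shows "inv\<^bsub>AutoGroup G\<^esub> a = restrict (inv_into (carrier G) a) (carrier G)"
  using assms(2) group.m_inv_consistent[OF group_BijGroup group.subgroup_auto[OF assms(1)] assms(2)]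
  by (simp add: AutoGroup_def inv_BijGroup auto_def)

theorem proposition2p8:
  fixes S :: "'a::topological_space set"
    and ori :: "'a \<Rightarrow> 'a chain set"
    and x :: 'a
    and g n :: nat
  assumes "closed_connected_surface S"
    and "is_orientation (top_of_set S) ori"
    and "has_genus S g" and "g \<ge> 1"
    and "n \<ge> 1"
    and "x \<in> S"
  shows "\<forall>\<phi> \<in> torelli_group S.
           \<forall>\<rho> \<in> rep_space (fundamental_group S x) (torus_group n).
             mod_action S x \<phi> \<rho> = \<rho>"
proof (intro ballI)
  let ?\<Pi> = "fundamental_group S x" and ?X = "top_of_set S"
  fix \<phi> \<rho> assume \<phi>: "\<phi> \<in> torelli_group S" and "\<rho> \<in> rep_space ?\<Pi> (torus_group n)"
  then have \<rho>: "\<rho> \<in> hom ?\<Pi> (torus_group n)" "\<rho> \<in> extensional (carrier ?\<Pi>)"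
    by (auto simp: rep_space_def)
  have \<phi>_class: "\<phi> \<in> carrier (mapping_class_group S)"
    using \<phi> by (simp add: torelli_group_def kernel_def)
  have S: "path_connected S"
    using assms(1) unfolding closed_connected_surface_def
    by (intro path_connected_if_locally_euclidean[where 'b = "real^2"]) auto
  \<comment> \<open>Every automorphism in the outer class is treated, since the definite description
    in \<open>mod_action\<close> requires a value independent of the choice.\<close>
  have fixed: "compose (carrier ?\<Pi>) \<rho> (inv\<^bsub>AutoGroup ?\<Pi>\<^esub> a) = \<rho>" if "a \<in> outer_auto S x \<phi>" for a
  proof -
    obtain f \<gamma> where a: "a = induced_auto S x f \<gamma>" and "f \<in> \<phi>"
      and \<gamma>: "path \<gamma>" "path_image \<gamma> \<subseteq> S" "pathstart \<gamma> = x" "pathfinish \<gamma> = f x"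
      using \<open>a \<in> outer_auto S x \<phi>\<close> by (auto simp: outer_auto_def)
    obtain f' where f': "homeomorphism S S f f'"
      using mapping_class_homeomorphism[OF \<phi>_class \<open>f \<in> \<phi>\<close>] .
    then have f: "continuous_on S f" "f ` S \<subseteq> S"
      by (auto simp: homeomorphism_def)
    have a_auto: "a \<in> auto ?\<Pi>"
      unfolding a using f' \<gamma> by (rule induced_auto_in_auto)
    have invariant: "\<rho> (a A) = \<rho> A" if A: "A \<in> carrier ?\<Pi>" for A
    proof -
      obtain p where p: "p \<in> loops_at S x" and A_eq: "A = path_class S p"
        using A by (auto simp: carrier_fundamental_group)
      have cycle: "singular_relcycle 1 ?X {} (frag_of (simplex_of_path p))"
        using p by (intro singular_relcycle_simplex_of_loop) (auto simp: loops_at_iff)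
      then have "homologous_rel_set 1 ?X {} (frag_of (simplex_of_path p)) \<in> carrier (homology_group 1 ?X)"
        using carrier_relative_homology_group[of 1 ?X "{}"] by auto
      then have "hom_induced 1 ?X {} ?X {} f (homologous_rel_set 1 ?X {} (frag_of (simplex_of_path p)))
          = homologous_rel_set 1 ?X {} (frag_of (simplex_of_path p))"
        by (rule torelli_group_hom_induced[OF \<phi> \<open>f \<in> \<phi>\<close>])
      moreover have "hom_induced 1 ?X {} ?X {} f (homologous_rel_set 1 ?X {} (frag_of (simplex_of_path p)))
          = homologous_rel_set 1 ?X {} (chain_map 1 f (frag_of (simplex_of_path p)))"
        using hom_induced_chain_map[of ?X ?X f "{}" "{}" 1, OF _ _ cycle] f
        by (simp add: image_subset_iff_funcset del: chain_map_of)
      ultimately have "homologous_rel_set 1 ?X {} (chain_map 1 f (frag_of (simplex_of_path p)))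
          = homologous_rel_set 1 ?X {} (frag_of (simplex_of_path p))"
        by simp
      \<comment> \<open>Equality of homology classes is turned back into a relation between the two
        loops as chains, the form in which the extension of \<open>\<rho>\<close> can use
        it.\<close>
      then have "homologous_rel 1 ?X {} (frag_of (simplex_of_path (f \<circ> p))) (frag_of (simplex_of_path p))"
        unfolding chain_map_simplex_of_path homologous_rel_set_eq .
      then show ?thesis
        unfolding A_eq a induced_auto_path_class[OF f \<gamma> p]
        by (rule comm_group.hom_fundamental_group_homologous[OF comm_group_torus_group S \<open>x \<in> S\<close> \<rho>(1) p loops_at_compose[OF p f] \<gamma>])
    qed
    have "a ` carrier ?\<Pi> = carrier ?\<Pi>"
      using a_auto by (simp add: auto_def Bij_def bij_betw_def)
    \<comment> \<open>Invariance under \<open>a\<close> passes to its inverse by evaluating it at a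
      preimage, which exists by surjectivity.\<close>
    then have "\<rho> (inv_into (carrier ?\<Pi>) a A) = \<rho> A" if "A \<in> carrier ?\<Pi>" for A
      using invariant[of "inv_into (carrier ?\<Pi>) a A"] that by (simp add: inv_into_into f_inv_into_f)
    then show ?thesis
      using \<rho>(2) a_auto inv_AutoGroup[OF group_fundamental_group[OF \<open>x \<in> S\<close>]]
      by (auto simp: compose_def extensional_def fun_eq_iff)
  qed
  \<comment> \<open>The definite description also needs a witness: a representative of the class and
    a path from \<open>x\<close> to its image.\<close>
  have "outer_auto S x \<phi> \<noteq> {}"
  proof -
    obtain f where "f \<in> \<phi>"
      using mapping_class_memD[OF \<phi>_class] by blast
    moreover obtain f' where "homeomorphism S S f f'"
      using mapping_class_homeomorphism[OF \<phi>_class \<open>f \<in> \<phi>\<close>] .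
    then have "f x \<in> S"
      using \<open>x \<in> S\<close> by (auto simp: homeomorphism_def)
    ultimately show ?thesis
      using S \<open>x \<in> S\<close> unfolding path_connected_def outer_auto_def by blast
  qed
  with fixed show "mod_action S x \<phi> \<rho> = \<rho>"
    unfolding mod_action_def by (intro the_equality) fastforce+
qed

end
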